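(* Let $\mathcal{Q}$ be a small quantaloid and let $\phi:\mathbb{A}\nrightarrow\mathbb{B}$ be a $\mathcal{Q}$-distributor between $\mathcal{Q}$-categories. Let $\phi^*:\mathcal{P}\mathbb{B}\to\mathcal{P}\mathbb{A}$ and $\phi_*:\mathcal{P}\mathbb{A}\to\mathcal{P}\mathbb{B}$ be the $\mathcal{Q}$-functors $\phi^*(\lambda)=\lambda\circ\phi$ and $\phi_*(\mu)=\mu\swarrow\phi$. Then $\phi^*$ is left adjoint to $\phi_*$ in the category of $\mathcal{Q}$-categories and $\mathcal{Q}$-functors, i.e. $\phi^*\dashv\phi_*$.
   Context: A small quantaloid $\mathcal{Q}$ is a category with a set $\mathcal{Q}_0$ of objects, each hom-set $\mathcal{Q}(A,B)$ a complete lattice, and composition $\circ$ preserving arbitrary joins in each variable. For $f\in\mathcal{Q}(A,B)$ and $g\in\mathcal{Q}(A,X)$, $g\swarrow f\in\mathcal{Q}(B,X)$ is the largest $h$ with $h\circ f\le g$. A $\mathcal{Q}$-category $\mathbb{A}$ is a set $\mathbb{A}_0$ with a type map $t:\mathbb{A}_0\to\mathcal{Q}_0$ and hom-arrows $\mathbb{A}(x,y)\in\mathcal{Q}(tx,ty)$ such that $1_{tx}\le\mathbb{A}(x,x)$ and $\mathbb{A}(y,z)\circ\mathbb{A}(x,y)\le\mathbb{A}(x,z)$. A $\mathcal{Q}$-functor $F:\mathbb{A}\to\mathbb{B}$ is a type-preserving map $\mathbb{A}_0\to\mathbb{B}_0$ with $\mathbb{A}(x,x')\le\mathbb{B}(Fx,Fx')$.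 Underlying preorder: $x\le y$ iff $tx=ty$ and $1_{tx}\le\mathbb{A}(x,y)$; $\mathcal{Q}$-functors are preordered pointwise. $F\dashv G$ (for $F:\mathbb{A}\to\mathbb{B}$, $G:\mathbb{B}\to\mathbb{A}$) means $1_{\mathbb{A}}\le G\circ F$ and $F\circ G\le 1_{\mathbb{B}}$. A $\mathcal{Q}$-distributor $\phi:\mathbb{A}\nrightarrow\mathbb{B}$ is a family $\phi(x,y)\in\mathcal{Q}(tx,ty)$ ($x\in\mathbb{A}_0,y\in\mathbb{B}_0$) with $\mathbb{B}(y',y)\circ\phi(x,y')\le\phi(x,y)$ and $\phi(x',y)\circ\mathbb{A}(x,x')\le\phi(x,y)$. For $\phi:\mathbb{A}\nrightarrow\mathbb{B}$, $\psi:\mathbb{B}\nrightarrow\mathbb{C}$, $\eta:\mathbb{A}\nrightarrow\mathbb{C}$: $(\psi\circ\phi)(x,z)=\bigvee_y\psi(y,z)\circ\phi(x,y)$; $\eta\swarrow\phi:\mathbb{B}\nrightarrow\mathbb{C}$ is $(\eta\swarrow\phi)(y,z)=\bigwedge_x\eta(x,z)\swarrow\phi(x,y)$. For $X\in\mathcal{Q}_0$, $*_X$ is the $\mathcal{Q}$-category with one object $*$ of type $X$ and hom-arrow $1_X$. $\mathcal{P}\mathbb{A}$ is the $\mathcal{Q}$-category whose objects of type $X$ are the distributors $\mu:\mathbb{A}\nrightarrow *_X$, with $\mathcal{P}\mathbb{A}(\mu,\lambda)=\lambda\swarrow\mu$. *)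

theory Defs
  imports "HOL-Algebra.Complete_Lattice" "HOL-Library.FuncSet"
begin

text \<open>
  Hom-sets are indexed by pairs of objects and need not be disjoint as subsets of \<open>'a\<close>, so
  composition carries its three objects: \<open>Comp Q A B C g f\<close> is $g \circ f : A \to C$ for
  $f : A \to B$ and $g : B \to C$.
\<close>

record ('o, 'a) quantaloid_data =
  Ob :: "'o set"
  Hom :: "'o \<Rightarrow> 'o \<Rightarrow> 'a gorder"
  Unit :: "'o \<Rightarrow> 'a"
  Comp :: "'o \<Rightarrow> 'o \<Rightarrow> 'o \<Rightarrow> 'a \<Rightarrow> 'a \<Rightarrow> 'a"

locale quantaloid =
  fixes Q :: "('o, 'a) quantaloid_data"
  assumes hom_complete_lattice:
      "\<lbrakk>A \<in> Ob Q; B \<in> Ob Q\<rbrakk> \<Longrightarrow> complete_lattice (Hom Q A B)"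
    and unit_closed: "A \<in> Ob Q \<Longrightarrow> Unit Q A \<in> carrier (Hom Q A A)"
    and comp_closed:
      "\<lbrakk>A \<in> Ob Q; B \<in> Ob Q; C \<in> Ob Q; f \<in> carrier (Hom Q A B); g \<in> carrier (Hom Q B C)\<rbrakk>
        \<Longrightarrow> Comp Q A B C g f \<in> carrier (Hom Q A C)"
    and comp_assoc:
      "\<lbrakk>A \<in> Ob Q; B \<in> Ob Q; C \<in> Ob Q; D \<in> Ob Q; f \<in> carrier (Hom Q A B);
        g \<in> carrier (Hom Q B C); h \<in> carrier (Hom Q C D)\<rbrakk>
        \<Longrightarrow> Comp Q A C D h (Comp Q A B C g f) = Comp Q A B D (Comp Q B C D h g) f"
    and unit_left:
      "\<lbrakk>A \<in> Ob Q; B \<in> Ob Q; f \<in> carrier (Hom Q A B)\<rbrakk> \<Longrightarrow> Comp Q A B B (Unit Q B) f = f"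
    and unit_right:
      "\<lbrakk>A \<in> Ob Q; B \<in> Ob Q; f \<in> carrier (Hom Q A B)\<rbrakk> \<Longrightarrow> Comp Q A A B f (Unit Q A) = f"
    and comp_sup_right:
      "\<lbrakk>A \<in> Ob Q; B \<in> Ob Q; C \<in> Ob Q; g \<in> carrier (Hom Q B C)\<rbrakk>
        \<Longrightarrow> sup_pres (Hom Q A B) (Hom Q A C) (\<lambda>f. Comp Q A B C g f)"
    and comp_sup_left:
      "\<lbrakk>A \<in> Ob Q; B \<in> Ob Q; C \<in> Ob Q; f \<in> carrier (Hom Q A B)\<rbrakk>
        \<Longrightarrow> sup_pres (Hom Q B C) (Hom Q A C) (\<lambda>g. Comp Q A B C g f)"

text \<open>\<open>limp Q A B X g f\<close> is $g \swarrow f \in Q(B,X)$ for $f \in Q(A,B)$ and $g \in Q(A,X)$.\<close>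

definition limp :: "('o, 'a) quantaloid_data \<Rightarrow> 'o \<Rightarrow> 'o \<Rightarrow> 'o \<Rightarrow> 'a \<Rightarrow> 'a \<Rightarrow> 'a" where
  "limp Q A B X g f =
    (THE h. greatest (Hom Q B X) h
      {h \<in> carrier (Hom Q B X). Comp Q A B X h f \<sqsubseteq>\<^bsub>Hom Q A X\<^esub> g})"

record ('o, 'a, 'x) qcat =
  Obj :: "'x set"
  tp :: "'x \<Rightarrow> 'o"
  Arr :: "'x \<Rightarrow> 'x \<Rightarrow> 'a"

definition qcategory :: "('o, 'a) quantaloid_data \<Rightarrow> ('o, 'a, 'x) qcat \<Rightarrow> bool" where
  "qcategory Q \<A> \<longleftrightarrow>
    tp \<A> \<in> Obj \<A> \<rightarrow> Ob Q \<and>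
    (\<forall>x\<in>Obj \<A>. \<forall>y\<in>Obj \<A>. Arr \<A> x y \<in> carrier (Hom Q (tp \<A> x) (tp \<A> y))) \<and>
    (\<forall>x\<in>Obj \<A>. Unit Q (tp \<A> x) \<sqsubseteq>\<^bsub>Hom Q (tp \<A> x) (tp \<A> x)\<^esub> Arr \<A> x x) \<and>
    (\<forall>x\<in>Obj \<A>. \<forall>y\<in>Obj \<A>. \<forall>z\<in>Obj \<A>.
      Comp Q (tp \<A> x) (tp \<A> y) (tp \<A> z) (Arr \<A> y z) (Arr \<A> x y)
        \<sqsubseteq>\<^bsub>Hom Q (tp \<A> x) (tp \<A> z)\<^esub> Arr \<A> x z)"

text \<open>Functors are extensional maps, so that two of them are equal iff they agree on objects.\<close>

definition qfunctor :: "('o, 'a) quantaloid_data \<Rightarrow> ('o, 'a, 'x) qcat \<Rightarrow> ('o, 'a, 'y) qcat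
    \<Rightarrow> ('x \<Rightarrow> 'y) \<Rightarrow> bool" where
  "qfunctor Q \<A> \<B> F \<longleftrightarrow>
    qcategory Q \<A> \<and> qcategory Q \<B> \<and>
    F \<in> Obj \<A> \<rightarrow>\<^sub>E Obj \<B> \<and>
    (\<forall>x\<in>Obj \<A>. tp \<B> (F x) = tp \<A> x) \<and>
    (\<forall>x\<in>Obj \<A>. \<forall>x'\<in>Obj \<A>.
      Arr \<A> x x' \<sqsubseteq>\<^bsub>Hom Q (tp \<A> x) (tp \<A> x')\<^esub> Arr \<B> (F x) (F x'))"

definition qle :: "('o, 'a) quantaloid_data \<Rightarrow> ('o, 'a, 'x) qcat \<Rightarrow> 'x \<Rightarrow> 'x \<Rightarrow> bool" where
  "qle Q \<A> x y \<longleftrightarrow>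
    tp \<A> x = tp \<A> y \<and> Unit Q (tp \<A> x) \<sqsubseteq>\<^bsub>Hom Q (tp \<A> x) (tp \<A> y)\<^esub> Arr \<A> x y"

definition qfunctor_le :: "('o, 'a) quantaloid_data \<Rightarrow> ('o, 'a, 'x) qcat \<Rightarrow> ('o, 'a, 'y) qcat
    \<Rightarrow> ('x \<Rightarrow> 'y) \<Rightarrow> ('x \<Rightarrow> 'y) \<Rightarrow> bool" where
  "qfunctor_le Q \<A> \<B> F G \<longleftrightarrow> (\<forall>x\<in>Obj \<A>. qle Q \<B> (F x) (G x))"

definition left_adjoint :: "('o, 'a) quantaloid_data \<Rightarrow> ('o, 'a, 'x) qcat \<Rightarrow> ('o, 'a, 'y) qcat
    \<Rightarrow> ('x \<Rightarrow> 'y) \<Rightarrow> ('y \<Rightarrow> 'x) \<Rightarrow> bool" where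
  "left_adjoint Q \<A> \<B> F G \<longleftrightarrow>
    qfunctor Q \<A> \<B> F \<and> qfunctor Q \<B> \<A> G \<and>
    qfunctor_le Q \<A> \<A> (\<lambda>x\<in>Obj \<A>. x) (compose (Obj \<A>) G F) \<and>
    qfunctor_le Q \<B> \<B> (compose (Obj \<B>) F G) (\<lambda>y\<in>Obj \<B>. y)"

text \<open>
  A distributor is a family indexed by \<^term>\<open>Obj \<A> \<times> Obj \<B>\<close>; the last conjunct
  fixes its junk values, so that equal families are equal as HOL functions.
\<close>

definition distributor :: "('o, 'a) quantaloid_data \<Rightarrow> ('o, 'a, 'x) qcat \<Rightarrow> ('o, 'a, 'y) qcat
    \<Rightarrow> ('x \<Rightarrow> 'y \<Rightarrow> 'a) \<Rightarrow> bool" where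
  "distributor Q \<A> \<B> \<phi> \<longleftrightarrow>
    (\<forall>x\<in>Obj \<A>. \<forall>y\<in>Obj \<B>. \<phi> x y \<in> carrier (Hom Q (tp \<A> x) (tp \<B> y))) \<and>
    (\<forall>x\<in>Obj \<A>. \<forall>y'\<in>Obj \<B>. \<forall>y\<in>Obj \<B>.
      Comp Q (tp \<A> x) (tp \<B> y') (tp \<B> y) (Arr \<B> y' y) (\<phi> x y')
        \<sqsubseteq>\<^bsub>Hom Q (tp \<A> x) (tp \<B> y)\<^esub> \<phi> x y) \<and>
    (\<forall>x\<in>Obj \<A>. \<forall>x'\<in>Obj \<A>. \<forall>y\<in>Obj \<B>.
      Comp Q (tp \<A> x) (tp \<A> x') (tp \<B> y) (\<phi> x' y) (Arr \<A> x x')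
        \<sqsubseteq>\<^bsub>Hom Q (tp \<A> x) (tp \<B> y)\<^esub> \<phi> x y) \<and>
    (\<forall>x y. \<not> (x \<in> Obj \<A> \<and> y \<in> Obj \<B>) \<longrightarrow> \<phi> x y = undefined)"

text \<open>\<open>dcomp Q \<A> \<B> \<C> \<psi> \<phi>\<close> is $\psi \circ \phi$; \<open>dlimp Q \<A> \<B> \<C> \<eta> \<phi>\<close> is $\eta \swarrow \phi$.\<close>

definition dcomp :: "('o, 'a) quantaloid_data \<Rightarrow> ('o, 'a, 'x) qcat \<Rightarrow> ('o, 'a, 'y) qcat
    \<Rightarrow> ('o, 'a, 'z) qcat \<Rightarrow> ('y \<Rightarrow> 'z \<Rightarrow> 'a) \<Rightarrow> ('x \<Rightarrow> 'y \<Rightarrow> 'a) \<Rightarrow> ('x \<Rightarrow> 'z \<Rightarrow> 'a)" where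
  "dcomp Q \<A> \<B> \<C> \<psi> \<phi> = (\<lambda>x z. if x \<in> Obj \<A> \<and> z \<in> Obj \<C>
    then \<Squnion>\<^bsub>Hom Q (tp \<A> x) (tp \<C> z)\<^esub>
      ((\<lambda>y. Comp Q (tp \<A> x) (tp \<B> y) (tp \<C> z) (\<psi> y z) (\<phi> x y)) ` Obj \<B>)
    else undefined)"

definition dlimp :: "('o, 'a) quantaloid_data \<Rightarrow> ('o, 'a, 'x) qcat \<Rightarrow> ('o, 'a, 'y) qcat
    \<Rightarrow> ('o, 'a, 'z) qcat \<Rightarrow> ('x \<Rightarrow> 'z \<Rightarrow> 'a) \<Rightarrow> ('x \<Rightarrow> 'y \<Rightarrow> 'a) \<Rightarrow> ('y \<Rightarrow> 'z \<Rightarrow> 'a)" where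
  "dlimp Q \<A> \<B> \<C> \<eta> \<phi> = (\<lambda>y z. if y \<in> Obj \<B> \<and> z \<in> Obj \<C>
    then \<Sqinter>\<^bsub>Hom Q (tp \<B> y) (tp \<C> z)\<^esub>
      ((\<lambda>x. limp Q (tp \<A> x) (tp \<B> y) (tp \<C> z) (\<eta> x z) (\<phi> x y)) ` Obj \<A>)
    else undefined)"

definition star :: "('o, 'a) quantaloid_data \<Rightarrow> 'o \<Rightarrow> ('o, 'a, unit) qcat" where
  "star Q X = \<lparr>Obj = {()}, tp = (\<lambda>_. X), Arr = (\<lambda>_ _. Unit Q X)\<rparr>"

text \<open>
  A presheaf is paired with its type, since the underlying function does not determine the
  type (for instance when \<^term>\<open>Obj \<A>\<close> is empty).
\<close>

definition presheaves :: "('o, 'a) quantaloid_data \<Rightarrow> ('o, 'a, 'x) qcat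
    \<Rightarrow> ('o, 'a, 'o \<times> ('x \<Rightarrow> unit \<Rightarrow> 'a)) qcat" where
  "presheaves Q \<A> = \<lparr>
    Obj = {(X, \<mu>). X \<in> Ob Q \<and> distributor Q \<A> (star Q X) \<mu>},
    tp = fst,
    Arr = (\<lambda>(X, \<mu>) (Y, \<nu>). dlimp Q \<A> (star Q X) (star Q Y) \<nu> \<mu> () ())\<rparr>"

text \<open>\<open>upper_star\<close> is $\phi^*$ and \<open>lower_star\<close> is $\phi_*$.\<close>

definition upper_star :: "('o, 'a) quantaloid_data \<Rightarrow> ('o, 'a, 'x) qcat \<Rightarrow> ('o, 'a, 'y) qcat
    \<Rightarrow> ('x \<Rightarrow> 'y \<Rightarrow> 'a)
    \<Rightarrow> 'o \<times> ('y \<Rightarrow> unit \<Rightarrow> 'a) \<Rightarrow> 'o \<times> ('x \<Rightarrow> unit \<Rightarrow> 'a)" where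
  "upper_star Q \<A> \<B> \<phi> =
    (\<lambda>(X, \<nu>)\<in>Obj (presheaves Q \<B>). (X, dcomp Q \<A> \<B> (star Q X) \<nu> \<phi>))"

definition lower_star :: "('o, 'a) quantaloid_data \<Rightarrow> ('o, 'a, 'x) qcat \<Rightarrow> ('o, 'a, 'y) qcat
    \<Rightarrow> ('x \<Rightarrow> 'y \<Rightarrow> 'a)
    \<Rightarrow> 'o \<times> ('x \<Rightarrow> unit \<Rightarrow> 'a) \<Rightarrow> 'o \<times> ('y \<Rightarrow> unit \<Rightarrow> 'a)" where
  "lower_star Q \<A> \<B> \<phi> =
    (\<lambda>(X, \<mu>)\<in>Obj (presheaves Q \<A>). (X, dlimp Q \<A> \<B> (star Q X) \<mu> \<phi>))"

end

theory Submission
  imports Defs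
begin

text \<open>
  Everything rests on two residuation properties, read off pointwise: an arrow $h$ lies below
  $(\eta \swarrow \phi)(y,z)$ iff $h \circ \phi(x,y) \le \eta(x,z)$ for all $x$
  (\<open>le_dlimp_iff\<close>), and $c \circ (\psi \circ \phi)(x,z) \le u$ iff
  $c \circ (\psi(y,z) \circ \phi(x,y)) \le u$ for all $y$ (\<open>comp_dcomp_le_iff\<close>), similarly on
  the other side. The first holds because precomposition preserves joins and so has a right
  adjoint; the second because postcomposition preserves joins.

  Once all meets and joins are removed in this way, each remaining inequality (the action laws for
  $\psi \circ \phi$ and $\eta \swarrow \phi$, the composition law of $\mathcal{P}\mathbb{A}$, the
  functoriality of $\phi^*$ and $\phi_*$) says that a threefold composite can be reassociated and
  two of its factors contracted by a known inequality (\<open>contract_left\<close>,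
  \<open>contract_right\<close>). Since $1 \le \mathcal{P}\mathbb{A}(\mu,\nu)$ means
  $\mu \le \nu$ pointwise when $\mu$ and $\nu$ have the same type, the unit and the counit of the adjunction are
  $\lambda \le (\lambda \circ \phi) \swarrow \phi$ and
  $(\mu \swarrow \phi) \circ \phi \le \mu$, which are instances of residuation.
\<close>

section \<open>Residuation in a quantaloid\<close>

context quantaloid
begin

lemma hom_refl:
  assumes "A \<in> Ob Q" "B \<in> Ob Q" "f \<in> carrier (Hom Q A B)"
  shows "f \<sqsubseteq>\<^bsub>Hom Q A B\<^esub> f"
proof -
  interpret L: complete_lattice "Hom Q A B" using assms by (intro hom_complete_lattice)
  show ?thesis using assms by simp
qed

lemma hom_trans:
  assumes "A \<in> Ob Q" "B \<in> Ob Q"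
    and "f \<sqsubseteq>\<^bsub>Hom Q A B\<^esub> g" "g \<sqsubseteq>\<^bsub>Hom Q A B\<^esub> h"
    and "f \<in> carrier (Hom Q A B)" "g \<in> carrier (Hom Q A B)" "h \<in> carrier (Hom Q A B)"
  shows "f \<sqsubseteq>\<^bsub>Hom Q A B\<^esub> h"
proof -
  interpret L: complete_lattice "Hom Q A B" using assms by (intro hom_complete_lattice)
  show ?thesis using assms L.le_trans by blast
qed

lemma hom_sup_closed:
  assumes "A \<in> Ob Q" "B \<in> Ob Q" "S \<subseteq> carrier (Hom Q A B)"
  shows "\<Squnion>\<^bsub>Hom Q A B\<^esub> S \<in> carrier (Hom Q A B)"
proof -
  interpret L: complete_lattice "Hom Q A B" using assms by (intro hom_complete_lattice)
  show ?thesis using assms by simp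
qed

lemma hom_inf_closed:
  assumes "A \<in> Ob Q" "B \<in> Ob Q" "S \<subseteq> carrier (Hom Q A B)"
  shows "\<Sqinter>\<^bsub>Hom Q A B\<^esub> S \<in> carrier (Hom Q A B)"
proof -
  interpret L: complete_lattice "Hom Q A B" using assms by (intro hom_complete_lattice)
  show ?thesis using assms by simp
qed

lemma hom_sup_le_iff:
  assumes "A \<in> Ob Q" "B \<in> Ob Q" "S \<subseteq> carrier (Hom Q A B)" "u \<in> carrier (Hom Q A B)"
  shows "\<Squnion>\<^bsub>Hom Q A B\<^esub> S \<sqsubseteq>\<^bsub>Hom Q A B\<^esub> u \<longleftrightarrow> (\<forall>f\<in>S. f \<sqsubseteq>\<^bsub>Hom Q A B\<^esub> u)"
proof -
  interpret L: complete_lattice "Hom Q A B" using assms by (intro hom_complete_lattice)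
  show ?thesis
    using assms L.sup_upper[of S] L.sup_least[of S u] L.sup_closed[of S] L.le_trans
    by (smt (verit, best) Upper_memI subset_eq)
qed

lemma hom_le_inf_iff:
  assumes "A \<in> Ob Q" "B \<in> Ob Q" "S \<subseteq> carrier (Hom Q A B)" "l \<in> carrier (Hom Q A B)"
  shows "l \<sqsubseteq>\<^bsub>Hom Q A B\<^esub> \<Sqinter>\<^bsub>Hom Q A B\<^esub> S \<longleftrightarrow> (\<forall>f\<in>S. l \<sqsubseteq>\<^bsub>Hom Q A B\<^esub> f)"
proof -
  interpret L: complete_lattice "Hom Q A B" using assms by (intro hom_complete_lattice)
  show ?thesis
    using assms L.inf_lower[of S] L.inf_greatest[of S l] L.inf_closed[of S] L.le_trans
    by (smt (verit, best) Lower_memI subset_eq)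
qed

lemma comp_Sup_le_iff:
  assumes "A \<in> Ob Q" "B \<in> Ob Q" "C \<in> Ob Q" "S \<subseteq> carrier (Hom Q A B)"
    and "g \<in> carrier (Hom Q B C)" "u \<in> carrier (Hom Q A C)"
  shows "Comp Q A B C g (\<Squnion>\<^bsub>Hom Q A B\<^esub> S) \<sqsubseteq>\<^bsub>Hom Q A C\<^esub> u
    \<longleftrightarrow> (\<forall>f\<in>S. Comp Q A B C g f \<sqsubseteq>\<^bsub>Hom Q A C\<^esub> u)"
proof -
  have "Comp Q A B C g (\<Squnion>\<^bsub>Hom Q A B\<^esub> S) = \<Squnion>\<^bsub>Hom Q A C\<^esub> ((\<lambda>f. Comp Q A B C g f) ` S)"
    using comp_sup_right[of A B C g] assms by (auto simp: sup_pres_def)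
  moreover have "(\<lambda>f. Comp Q A B C g f) ` S \<subseteq> carrier (Hom Q A C)"
    using assms by (auto intro: comp_closed)
  ultimately show ?thesis using assms by (simp add: hom_sup_le_iff)
qed

lemma Sup_comp_le_iff:
  assumes "A \<in> Ob Q" "B \<in> Ob Q" "C \<in> Ob Q" "S \<subseteq> carrier (Hom Q B C)"
    and "f \<in> carrier (Hom Q A B)" "u \<in> carrier (Hom Q A C)"
  shows "Comp Q A B C (\<Squnion>\<^bsub>Hom Q B C\<^esub> S) f \<sqsubseteq>\<^bsub>Hom Q A C\<^esub> u
    \<longleftrightarrow> (\<forall>g\<in>S. Comp Q A B C g f \<sqsubseteq>\<^bsub>Hom Q A C\<^esub> u)"
proof -
  have "Comp Q A B C (\<Squnion>\<^bsub>Hom Q B C\<^esub> S) f = \<Squnion>\<^bsub>Hom Q A C\<^esub> ((\<lambda>g. Comp Q A B C g f) ` S)"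
    using comp_sup_left[of A B C f] assms by (auto simp: sup_pres_def)
  moreover have "(\<lambda>g. Comp Q A B C g f) ` S \<subseteq> carrier (Hom Q A C)"
    using assms by (auto intro: comp_closed)
  ultimately show ?thesis using assms by (simp add: hom_sup_le_iff)
qed

text \<open>
  Monotonicity is preservation of the join of the down-set of the larger arrow, which is that
  arrow itself.
\<close>

lemma comp_mono_right:
  assumes "A \<in> Ob Q" "B \<in> Ob Q" "C \<in> Ob Q"
    and "f \<in> carrier (Hom Q A B)" "f' \<in> carrier (Hom Q A B)" "g \<in> carrier (Hom Q B C)"
    and "f \<sqsubseteq>\<^bsub>Hom Q A B\<^esub> f'"
  shows "Comp Q A B C g f \<sqsubseteq>\<^bsub>Hom Q A C\<^esub> Comp Q A B C g f'"
proof -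
  interpret L: complete_lattice "Hom Q A B" using assms by (intro hom_complete_lattice)
  let ?S = "{h \<in> carrier (Hom Q A B). h \<sqsubseteq>\<^bsub>Hom Q A B\<^esub> f'}"
  have S: "?S \<subseteq> carrier (Hom Q A B)" by auto
  have "\<Squnion>\<^bsub>Hom Q A B\<^esub> ?S = f'"
    using assms S by (intro L.le_antisym L.sup_upper L.sup_closed) (auto simp: hom_sup_le_iff)
  then have "Comp Q A B C g (\<Squnion>\<^bsub>Hom Q A B\<^esub> ?S) \<sqsubseteq>\<^bsub>Hom Q A C\<^esub> Comp Q A B C g f'"
    using assms by (simp add: hom_refl comp_closed)
  then show ?thesis
    using assms S comp_Sup_le_iff[of A B C ?S g "Comp Q A B C g f'"] by (simp add: comp_closed)
qed

lemma comp_mono_left: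
  assumes "A \<in> Ob Q" "B \<in> Ob Q" "C \<in> Ob Q"
    and "f \<in> carrier (Hom Q A B)" "g \<in> carrier (Hom Q B C)" "g' \<in> carrier (Hom Q B C)"
    and "g \<sqsubseteq>\<^bsub>Hom Q B C\<^esub> g'"
  shows "Comp Q A B C g f \<sqsubseteq>\<^bsub>Hom Q A C\<^esub> Comp Q A B C g' f"
proof -
  interpret L: complete_lattice "Hom Q B C" using assms by (intro hom_complete_lattice)
  let ?S = "{h \<in> carrier (Hom Q B C). h \<sqsubseteq>\<^bsub>Hom Q B C\<^esub> g'}"
  have S: "?S \<subseteq> carrier (Hom Q B C)" by auto
  have "\<Squnion>\<^bsub>Hom Q B C\<^esub> ?S = g'"
    using assms S by (intro L.le_antisym L.sup_upper L.sup_closed) (auto simp: hom_sup_le_iff)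
  then have "Comp Q A B C (\<Squnion>\<^bsub>Hom Q B C\<^esub> ?S) f \<sqsubseteq>\<^bsub>Hom Q A C\<^esub> Comp Q A B C g' f"
    using assms by (simp add: hom_refl comp_closed)
  then show ?thesis
    using assms S Sup_comp_le_iff[of A B C ?S f "Comp Q A B C g' f"] by (simp add: comp_closed)
qed

text \<open>
  The two contraction rules carry all the later calculations: of a threefold composite, the two
  factors that the bracketing keeps apart are contracted to \<open>m\<close>.
\<close>

lemma contract_left:
  assumes "A \<in> Ob Q" "B \<in> Ob Q" "C \<in> Ob Q" "D \<in> Ob Q"
    and "f \<in> carrier (Hom Q A B)" "k \<in> carrier (Hom Q B C)" "h \<in> carrier (Hom Q C D)"
    and "m \<in> carrier (Hom Q B D)" "u \<in> carrier (Hom Q A D)"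
    and "Comp Q B C D h k \<sqsubseteq>\<^bsub>Hom Q B D\<^esub> m" "Comp Q A B D m f \<sqsubseteq>\<^bsub>Hom Q A D\<^esub> u"
  shows "Comp Q A C D h (Comp Q A B C k f) \<sqsubseteq>\<^bsub>Hom Q A D\<^esub> u"
proof -
  have "Comp Q A B D (Comp Q B C D h k) f \<sqsubseteq>\<^bsub>Hom Q A D\<^esub> Comp Q A B D m f"
    using assms by (intro comp_mono_left comp_closed)
  then have "Comp Q A B D (Comp Q B C D h k) f \<sqsubseteq>\<^bsub>Hom Q A D\<^esub> u"
    using assms by (meson hom_trans comp_closed)
  then show ?thesis using assms by (simp add: comp_assoc)
qed

lemma contract_right:
  assumes "A \<in> Ob Q" "B \<in> Ob Q" "C \<in> Ob Q" "D \<in> Ob Q"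
    and "f \<in> carrier (Hom Q A B)" "k \<in> carrier (Hom Q B C)" "h \<in> carrier (Hom Q C D)"
    and "m \<in> carrier (Hom Q A C)" "u \<in> carrier (Hom Q A D)"
    and "Comp Q A B C k f \<sqsubseteq>\<^bsub>Hom Q A C\<^esub> m" "Comp Q A C D h m \<sqsubseteq>\<^bsub>Hom Q A D\<^esub> u"
  shows "Comp Q A B D (Comp Q B C D h k) f \<sqsubseteq>\<^bsub>Hom Q A D\<^esub> u"
proof -
  have "Comp Q A C D h (Comp Q A B C k f) \<sqsubseteq>\<^bsub>Hom Q A D\<^esub> Comp Q A C D h m"
    using assms by (intro comp_mono_right comp_closed)
  then have "Comp Q A C D h (Comp Q A B C k f) \<sqsubseteq>\<^bsub>Hom Q A D\<^esub> u"
    using assms by (meson hom_trans comp_closed)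
  then show ?thesis using assms by (simp add: comp_assoc)
qed

text \<open>
  The largest $h$ with $h \circ f \le g$ is the join of all such $h$, which has the property itself
  because composition with $f$ preserves that join.
\<close>

lemma limp_greatest:
  assumes "A \<in> Ob Q" "B \<in> Ob Q" "X \<in> Ob Q" "f \<in> carrier (Hom Q A B)" "g \<in> carrier (Hom Q A X)"
  shows "greatest (Hom Q B X) (limp Q A B X g f)
    {h \<in> carrier (Hom Q B X). Comp Q A B X h f \<sqsubseteq>\<^bsub>Hom Q A X\<^esub> g}"
proof -
  interpret L: complete_lattice "Hom Q B X" using assms by (intro hom_complete_lattice)
  let ?S = "{h \<in> carrier (Hom Q B X). Comp Q A B X h f \<sqsubseteq>\<^bsub>Hom Q A X\<^esub> g}"
  have S: "?S \<subseteq> carrier (Hom Q B X)" by auto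
  then have sup: "greatest (Hom Q B X) (\<Squnion>\<^bsub>Hom Q B X\<^esub> ?S) ?S"
    unfolding greatest_def
    using assms L.sup_closed[OF S] L.sup_upper[OF S] Sup_comp_le_iff[of A B X ?S f g]
    by auto
  show ?thesis
    unfolding limp_def using sup L.greatest_unique[OF _ sup]
    by (rule theI[where P = "\<lambda>h. greatest (Hom Q B X) h ?S"])
qed

lemma limp_closed:
  assumes "A \<in> Ob Q" "B \<in> Ob Q" "X \<in> Ob Q" "f \<in> carrier (Hom Q A B)" "g \<in> carrier (Hom Q A X)"
  shows "limp Q A B X g f \<in> carrier (Hom Q B X)"
  using limp_greatest[OF assms] by (auto simp: greatest_def)

lemma le_limp_iff:
  assumes "A \<in> Ob Q" "B \<in> Ob Q" "X \<in> Ob Q" "f \<in> carrier (Hom Q A B)" "g \<in> carrier (Hom Q A X)"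
    and "h \<in> carrier (Hom Q B X)"
  shows "h \<sqsubseteq>\<^bsub>Hom Q B X\<^esub> limp Q A B X g f \<longleftrightarrow> Comp Q A B X h f \<sqsubseteq>\<^bsub>Hom Q A X\<^esub> g"
proof
  assume "h \<sqsubseteq>\<^bsub>Hom Q B X\<^esub> limp Q A B X g f"
  then have "Comp Q A B X h f \<sqsubseteq>\<^bsub>Hom Q A X\<^esub> Comp Q A B X (limp Q A B X g f) f"
    using assms by (intro comp_mono_left limp_closed)
  moreover have "Comp Q A B X (limp Q A B X g f) f \<sqsubseteq>\<^bsub>Hom Q A X\<^esub> g"
    using limp_greatest[OF assms(1-5)] by (auto simp: greatest_def)
  ultimately show "Comp Q A B X h f \<sqsubseteq>\<^bsub>Hom Q A X\<^esub> g"
    using assms by (meson hom_trans comp_closed limp_closed)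
next
  assume "Comp Q A B X h f \<sqsubseteq>\<^bsub>Hom Q A X\<^esub> g"
  then show "h \<sqsubseteq>\<^bsub>Hom Q B X\<^esub> limp Q A B X g f"
    using limp_greatest[OF assms(1-5)] assms(6) by (auto simp: greatest_def)
qed

end

section \<open>Composition and implication of distributors\<close>

text \<open>
  The universal properties of \<^const>\<open>dcomp\<close> and \<^const>\<open>dlimp\<close> concern only the types of the
  entries, so they are stated for matrices of arrows rather than for distributors.
\<close>

definition hom_matrix :: "('o, 'a) quantaloid_data \<Rightarrow> ('o, 'a, 'x) qcat \<Rightarrow> ('o, 'a, 'y) qcat
    \<Rightarrow> ('x \<Rightarrow> 'y \<Rightarrow> 'a) \<Rightarrow> bool" where
  "hom_matrix Q \<A> \<B> \<phi> \<longleftrightarrow> tp \<A> \<in> Obj \<A> \<rightarrow> Ob Q \<and> tp \<B> \<in> Obj \<B> \<rightarrow> Ob Q \<and>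
    (\<forall>x\<in>Obj \<A>. \<forall>y\<in>Obj \<B>. \<phi> x y \<in> carrier (Hom Q (tp \<A> x) (tp \<B> y)))"

lemma hom_matrixD:
  assumes "hom_matrix Q \<A> \<B> \<phi>"
  shows "x \<in> Obj \<A> \<Longrightarrow> tp \<A> x \<in> Ob Q" "y \<in> Obj \<B> \<Longrightarrow> tp \<B> y \<in> Ob Q"
    "x \<in> Obj \<A> \<Longrightarrow> y \<in> Obj \<B> \<Longrightarrow> \<phi> x y \<in> carrier (Hom Q (tp \<A> x) (tp \<B> y))"
  using assms by (auto simp: hom_matrix_def)

lemma qcategory_matrix: "qcategory Q \<A> \<Longrightarrow> hom_matrix Q \<A> \<A> (Arr \<A>)"
  by (simp add: qcategory_def hom_matrix_def)

lemma distributor_matrix: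
  "qcategory Q \<A> \<Longrightarrow> qcategory Q \<B> \<Longrightarrow> distributor Q \<A> \<B> \<phi> \<Longrightarrow> hom_matrix Q \<A> \<B> \<phi>"
  by (simp add: qcategory_def distributor_def hom_matrix_def)

lemma distributor_left_action:
  assumes "distributor Q \<A> \<B> \<phi>" "x \<in> Obj \<A>" "y' \<in> Obj \<B>" "y \<in> Obj \<B>"
  shows "Comp Q (tp \<A> x) (tp \<B> y') (tp \<B> y) (Arr \<B> y' y) (\<phi> x y')
    \<sqsubseteq>\<^bsub>Hom Q (tp \<A> x) (tp \<B> y)\<^esub> \<phi> x y"
  using assms by (simp add: distributor_def)

lemma distributor_right_action:
  assumes "distributor Q \<A> \<B> \<phi>" "x \<in> Obj \<A>" "x' \<in> Obj \<A>" "y \<in> Obj \<B>"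
  shows "Comp Q (tp \<A> x) (tp \<A> x') (tp \<B> y) (\<phi> x' y) (Arr \<A> x x')
    \<sqsubseteq>\<^bsub>Hom Q (tp \<A> x) (tp \<B> y)\<^esub> \<phi> x y"
  using assms by (simp add: distributor_def)

context quantaloid
begin

lemma dcomp_terms_closed:
  assumes "hom_matrix Q \<A> \<B> \<phi>" "hom_matrix Q \<B> \<C> \<psi>" "x \<in> Obj \<A>" "z \<in> Obj \<C>"
  shows "(\<lambda>y. Comp Q (tp \<A> x) (tp \<B> y) (tp \<C> z) (\<psi> y z) (\<phi> x y)) ` Obj \<B>
    \<subseteq> carrier (Hom Q (tp \<A> x) (tp \<C> z))"
  using assms by (auto intro!: comp_closed dest: hom_matrixD)

lemma dcomp_matrix:
  assumes "hom_matrix Q \<A> \<B> \<phi>" "hom_matrix Q \<B> \<C> \<psi>"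
  shows "hom_matrix Q \<A> \<C> (dcomp Q \<A> \<B> \<C> \<psi> \<phi>)"
  using hom_matrixD[OF assms(1)] hom_matrixD[OF assms(2)]
  by (simp add: hom_matrix_def dcomp_def hom_sup_closed dcomp_terms_closed[OF assms])

lemma comp_le_dcomp:
  assumes "hom_matrix Q \<A> \<B> \<phi>" "hom_matrix Q \<B> \<C> \<psi>"
    and "x \<in> Obj \<A>" "y \<in> Obj \<B>" "z \<in> Obj \<C>"
  shows "Comp Q (tp \<A> x) (tp \<B> y) (tp \<C> z) (\<psi> y z) (\<phi> x y)
    \<sqsubseteq>\<^bsub>Hom Q (tp \<A> x) (tp \<C> z)\<^esub> dcomp Q \<A> \<B> \<C> \<psi> \<phi> x z"
proof -
  interpret L: complete_lattice "Hom Q (tp \<A> x) (tp \<C> z)"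
    using assms by (intro hom_complete_lattice) (auto dest: hom_matrixD)
  show ?thesis
    using assms dcomp_terms_closed[OF assms(1,2,3,5)] by (auto simp: dcomp_def intro!: L.sup_upper)
qed

lemma dcomp_le_iff:
  assumes "hom_matrix Q \<A> \<B> \<phi>" "hom_matrix Q \<B> \<C> \<psi>" "x \<in> Obj \<A>" "z \<in> Obj \<C>"
    and "u \<in> carrier (Hom Q (tp \<A> x) (tp \<C> z))"
  shows "dcomp Q \<A> \<B> \<C> \<psi> \<phi> x z \<sqsubseteq>\<^bsub>Hom Q (tp \<A> x) (tp \<C> z)\<^esub> u \<longleftrightarrow>
    (\<forall>y\<in>Obj \<B>. Comp Q (tp \<A> x) (tp \<B> y) (tp \<C> z) (\<psi> y z) (\<phi> x y)
      \<sqsubseteq>\<^bsub>Hom Q (tp \<A> x) (tp \<C> z)\<^esub> u)"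
  using assms dcomp_terms_closed[OF assms(1-4)]
  by (simp add: dcomp_def hom_sup_le_iff hom_matrixD[OF assms(1)] hom_matrixD[OF assms(2)])

lemma comp_dcomp_le_iff:
  assumes "hom_matrix Q \<A> \<B> \<phi>" "hom_matrix Q \<B> \<C> \<psi>" "x \<in> Obj \<A>" "z \<in> Obj \<C>" "D \<in> Ob Q"
    and "c \<in> carrier (Hom Q (tp \<C> z) D)" "u \<in> carrier (Hom Q (tp \<A> x) D)"
  shows "Comp Q (tp \<A> x) (tp \<C> z) D c (dcomp Q \<A> \<B> \<C> \<psi> \<phi> x z)
      \<sqsubseteq>\<^bsub>Hom Q (tp \<A> x) D\<^esub> u \<longleftrightarrow>
    (\<forall>y\<in>Obj \<B>. Comp Q (tp \<A> x) (tp \<C> z) D c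
      (Comp Q (tp \<A> x) (tp \<B> y) (tp \<C> z) (\<psi> y z) (\<phi> x y)) \<sqsubseteq>\<^bsub>Hom Q (tp \<A> x) D\<^esub> u)"
  using assms dcomp_terms_closed[OF assms(1-4)]
  by (simp add: dcomp_def comp_Sup_le_iff hom_matrixD[OF assms(1)] hom_matrixD[OF assms(2)])

lemma dcomp_comp_le_iff:
  assumes "hom_matrix Q \<A> \<B> \<phi>" "hom_matrix Q \<B> \<C> \<psi>" "x \<in> Obj \<A>" "z \<in> Obj \<C>" "D \<in> Ob Q"
    and "c \<in> carrier (Hom Q D (tp \<A> x))" "u \<in> carrier (Hom Q D (tp \<C> z))"
  shows "Comp Q D (tp \<A> x) (tp \<C> z) (dcomp Q \<A> \<B> \<C> \<psi> \<phi> x z) c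
      \<sqsubseteq>\<^bsub>Hom Q D (tp \<C> z)\<^esub> u \<longleftrightarrow>
    (\<forall>y\<in>Obj \<B>. Comp Q D (tp \<A> x) (tp \<C> z)
      (Comp Q (tp \<A> x) (tp \<B> y) (tp \<C> z) (\<psi> y z) (\<phi> x y)) c \<sqsubseteq>\<^bsub>Hom Q D (tp \<C> z)\<^esub> u)"
  using assms dcomp_terms_closed[OF assms(1-4)]
  by (simp add: dcomp_def Sup_comp_le_iff hom_matrixD[OF assms(1)] hom_matrixD[OF assms(2)])

lemma dlimp_terms_closed:
  assumes "hom_matrix Q \<A> \<B> \<phi>" "hom_matrix Q \<A> \<C> \<eta>" "y \<in> Obj \<B>" "z \<in> Obj \<C>"
  shows "(\<lambda>x. limp Q (tp \<A> x) (tp \<B> y) (tp \<C> z) (\<eta> x z) (\<phi> x y)) ` Obj \<A>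
    \<subseteq> carrier (Hom Q (tp \<B> y) (tp \<C> z))"
  using assms by (auto intro!: limp_closed dest: hom_matrixD)

lemma dlimp_matrix:
  assumes "hom_matrix Q \<A> \<B> \<phi>" "hom_matrix Q \<A> \<C> \<eta>"
  shows "hom_matrix Q \<B> \<C> (dlimp Q \<A> \<B> \<C> \<eta> \<phi>)"
  using hom_matrixD[OF assms(1)] hom_matrixD[OF assms(2)]
  by (simp add: hom_matrix_def dlimp_def hom_inf_closed dlimp_terms_closed[OF assms])

lemma le_dlimp_iff:
  assumes "hom_matrix Q \<A> \<B> \<phi>" "hom_matrix Q \<A> \<C> \<eta>" "y \<in> Obj \<B>" "z \<in> Obj \<C>"
    and "h \<in> carrier (Hom Q (tp \<B> y) (tp \<C> z))"
  shows "h \<sqsubseteq>\<^bsub>Hom Q (tp \<B> y) (tp \<C> z)\<^esub> dlimp Q \<A> \<B> \<C> \<eta> \<phi> y z \<longleftrightarrow>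
    (\<forall>x\<in>Obj \<A>. Comp Q (tp \<A> x) (tp \<B> y) (tp \<C> z) h (\<phi> x y)
      \<sqsubseteq>\<^bsub>Hom Q (tp \<A> x) (tp \<C> z)\<^esub> \<eta> x z)"
  using assms dlimp_terms_closed[OF assms(1-4)]
  by (simp add: dlimp_def hom_le_inf_iff le_limp_iff
      hom_matrixD[OF assms(1)] hom_matrixD[OF assms(2)])

lemma dlimp_comp_le:
  assumes "hom_matrix Q \<A> \<B> \<phi>" "hom_matrix Q \<A> \<C> \<eta>"
    and "x \<in> Obj \<A>" "y \<in> Obj \<B>" "z \<in> Obj \<C>"
  shows "Comp Q (tp \<A> x) (tp \<B> y) (tp \<C> z) (dlimp Q \<A> \<B> \<C> \<eta> \<phi> y z) (\<phi> x y)
    \<sqsubseteq>\<^bsub>Hom Q (tp \<A> x) (tp \<C> z)\<^esub> \<eta> x z"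
proof -
  note m = hom_matrixD[OF dlimp_matrix[OF assms(1,2)]]
  have "dlimp Q \<A> \<B> \<C> \<eta> \<phi> y z \<sqsubseteq>\<^bsub>Hom Q (tp \<B> y) (tp \<C> z)\<^esub> dlimp Q \<A> \<B> \<C> \<eta> \<phi> y z"
    using assms by (intro hom_refl m)
  then show ?thesis using assms m by (simp add: le_dlimp_iff)
qed

text \<open>
  Composition on the left acts on $\psi$ alone and composition on the right on $\phi$ alone, so each
  action law of $\psi \circ \phi$ is inherited from one of the two factors.
\<close>

lemma dcomp_distributor:
  assumes cat: "qcategory Q \<A>" "qcategory Q \<B>" "qcategory Q \<C>"
    and \<phi>: "distributor Q \<A> \<B> \<phi>" and \<psi>: "distributor Q \<B> \<C> \<psi>"
  shows "distributor Q \<A> \<C> (dcomp Q \<A> \<B> \<C> \<psi> \<phi>)"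
proof -
  note m\<phi> = distributor_matrix[OF cat(1,2) \<phi>] and m\<psi> = distributor_matrix[OF cat(2,3) \<psi>]
  note m = hom_matrixD[OF m\<phi>] hom_matrixD[OF m\<psi>] hom_matrixD[OF dcomp_matrix[OF m\<phi> m\<psi>]]
    hom_matrixD[OF qcategory_matrix[OF cat(1)]] hom_matrixD[OF qcategory_matrix[OF cat(3)]]
  have "Comp Q (tp \<A> x) (tp \<C> z') (tp \<C> z) (Arr \<C> z' z) (dcomp Q \<A> \<B> \<C> \<psi> \<phi> x z')
      \<sqsubseteq>\<^bsub>Hom Q (tp \<A> x) (tp \<C> z)\<^esub> dcomp Q \<A> \<B> \<C> \<psi> \<phi> x z"
    if "x \<in> Obj \<A>" "z' \<in> Obj \<C>" "z \<in> Obj \<C>" for x z' z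
    using that m
    by (auto simp: comp_dcomp_le_iff[OF m\<phi> m\<psi>]
        intro!: contract_left[where m = "\<psi> _ z"] distributor_left_action[OF \<psi>]
          comp_le_dcomp[OF m\<phi> m\<psi>])
  moreover have "Comp Q (tp \<A> x) (tp \<A> x') (tp \<C> z) (dcomp Q \<A> \<B> \<C> \<psi> \<phi> x' z) (Arr \<A> x x')
      \<sqsubseteq>\<^bsub>Hom Q (tp \<A> x) (tp \<C> z)\<^esub> dcomp Q \<A> \<B> \<C> \<psi> \<phi> x z"
    if "x \<in> Obj \<A>" "x' \<in> Obj \<A>" "z \<in> Obj \<C>" for x x' z
    using that m
    by (auto simp: dcomp_comp_le_iff[OF m\<phi> m\<psi>]
        intro!: contract_right[where m = "\<phi> x _"] distributor_right_action[OF \<phi>]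
          comp_le_dcomp[OF m\<phi> m\<psi>])
  ultimately show ?thesis
    unfolding distributor_def using m by (auto simp: dcomp_def)
qed

text \<open>
  After transposition along \<open>\<phi>\<close>, the left action law is that of $\eta$ and the right one comes
  from the left action law of $\phi$, since $\phi$ occurs contravariantly.
\<close>

lemma dlimp_distributor:
  assumes cat: "qcategory Q \<A>" "qcategory Q \<B>" "qcategory Q \<C>"
    and \<phi>: "distributor Q \<A> \<B> \<phi>" and \<eta>: "distributor Q \<A> \<C> \<eta>"
  shows "distributor Q \<B> \<C> (dlimp Q \<A> \<B> \<C> \<eta> \<phi>)"
proof -
  note m\<phi> = distributor_matrix[OF cat(1,2) \<phi>] and m\<eta> = distributor_matrix[OF cat(1,3) \<eta>]
  note m = hom_matrixD[OF m\<phi>] hom_matrixD[OF m\<eta>] hom_matrixD[OF dlimp_matrix[OF m\<phi> m\<eta>]]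
    hom_matrixD[OF qcategory_matrix[OF cat(2)]] hom_matrixD[OF qcategory_matrix[OF cat(3)]]
  have "Comp Q (tp \<B> y) (tp \<C> z') (tp \<C> z) (Arr \<C> z' z) (dlimp Q \<A> \<B> \<C> \<eta> \<phi> y z')
      \<sqsubseteq>\<^bsub>Hom Q (tp \<B> y) (tp \<C> z)\<^esub> dlimp Q \<A> \<B> \<C> \<eta> \<phi> y z"
    if "y \<in> Obj \<B>" "z' \<in> Obj \<C>" "z \<in> Obj \<C>" for y z' z
    using that m
    by (auto simp: le_dlimp_iff[OF m\<phi> m\<eta>] comp_closed
        intro!: contract_right[where m = "\<eta> _ z'"] distributor_left_action[OF \<eta>]
          dlimp_comp_le[OF m\<phi> m\<eta>])
  moreover have "Comp Q (tp \<B> y) (tp \<B> y') (tp \<C> z) (dlimp Q \<A> \<B> \<C> \<eta> \<phi> y' z) (Arr \<B> y y')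
      \<sqsubseteq>\<^bsub>Hom Q (tp \<B> y) (tp \<C> z)\<^esub> dlimp Q \<A> \<B> \<C> \<eta> \<phi> y z"
    if "y \<in> Obj \<B>" "y' \<in> Obj \<B>" "z \<in> Obj \<C>" for y y' z
    using that m
    by (auto simp: le_dlimp_iff[OF m\<phi> m\<eta>] comp_closed
        intro!: contract_right[where m = "\<phi> _ y'"] distributor_left_action[OF \<phi>]
          dlimp_comp_le[OF m\<phi> m\<eta>])
  ultimately show ?thesis
    unfolding distributor_def using m by (auto simp: dlimp_def)
qed

section \<open>Categories of presheaves\<close>

lemma star_simps [simp]: "Obj (star Q X) = {()}" "tp (star Q X) u = X"
  by (simp_all add: star_def)

lemma star_qcategory: "X \<in> Ob Q \<Longrightarrow> qcategory Q (star Q X)"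
  by (simp add: qcategory_def star_def unit_closed unit_left hom_refl)

lemma presheaf_matrix:
  assumes "qcategory Q \<A>" "(X, \<mu>) \<in> Obj (presheaves Q \<A>)"
  shows "hom_matrix Q \<A> (star Q X) \<mu>"
  using assms by (auto simp: presheaves_def intro!: distributor_matrix star_qcategory)

lemma presheaf_type: "p \<in> Obj (presheaves Q \<A>) \<Longrightarrow> fst p \<in> Ob Q"
  by (auto simp: presheaves_def)

lemma tp_presheaves [simp]: "tp (presheaves Q \<A>) = fst"
  by (simp add: presheaves_def)

lemma presheaf_closed:
  assumes "qcategory Q \<A>" "p \<in> Obj (presheaves Q \<A>)" "x \<in> Obj \<A>"
  shows "snd p x () \<in> carrier (Hom Q (tp \<A> x) (fst p))"
  using hom_matrixD(3)[OF presheaf_matrix[of \<A> "fst p" "snd p"], of x "()"] assms by simp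

lemma presheaves_hom_closed:
  assumes "qcategory Q \<A>" "p \<in> Obj (presheaves Q \<A>)" "q \<in> Obj (presheaves Q \<A>)"
  shows "Arr (presheaves Q \<A>) p q \<in> carrier (Hom Q (fst p) (fst q))"
  using hom_matrixD(3)[OF dlimp_matrix[OF presheaf_matrix[of \<A> "fst p" "snd p"]
        presheaf_matrix[of \<A> "fst q" "snd q"]], of "()" "()"] assms
  by (auto simp: presheaves_def split: prod.splits)

text \<open>
  Presheaf homs enter the later proofs only through this characterisation of the arrows below
  them, which hides the infimum over the base category.
\<close>

lemma le_presheaves_hom_iff:
  assumes "qcategory Q \<A>" "p \<in> Obj (presheaves Q \<A>)" "q \<in> Obj (presheaves Q \<A>)"
    and "h \<in> carrier (Hom Q (fst p) (fst q))"
  shows "h \<sqsubseteq>\<^bsub>Hom Q (fst p) (fst q)\<^esub> Arr (presheaves Q \<A>) p q \<longleftrightarrow>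
    (\<forall>x\<in>Obj \<A>. Comp Q (tp \<A> x) (fst p) (fst q) h (snd p x ())
      \<sqsubseteq>\<^bsub>Hom Q (tp \<A> x) (fst q)\<^esub> snd q x ())"
  using le_dlimp_iff[OF presheaf_matrix[of \<A> "fst p" "snd p"]
        presheaf_matrix[of \<A> "fst q" "snd q"], of "()" "()" h] assms
  by (auto simp: presheaves_def split: prod.splits)

lemma presheaves_hom_comp_le:
  assumes "qcategory Q \<A>" "p \<in> Obj (presheaves Q \<A>)" "q \<in> Obj (presheaves Q \<A>)" "x \<in> Obj \<A>"
  shows "Comp Q (tp \<A> x) (fst p) (fst q) (Arr (presheaves Q \<A>) p q) (snd p x ())
    \<sqsubseteq>\<^bsub>Hom Q (tp \<A> x) (fst q)\<^esub> snd q x ()"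
  using assms le_presheaves_hom_iff[OF assms(1-3) presheaves_hom_closed[OF assms(1-3)]]
    hom_refl[OF _ _ presheaves_hom_closed[OF assms(1-3)]] presheaf_type
  by blast

text \<open>
  The case of an identity arrow in \<open>le_presheaves_hom_iff\<close>. It reduces the unit and the counit
  of the adjunction to pointwise inequalities.
\<close>

lemma presheaves_qle_iff:
  assumes "qcategory Q \<A>" "p \<in> Obj (presheaves Q \<A>)" "q \<in> Obj (presheaves Q \<A>)"
  shows "qle Q (presheaves Q \<A>) p q \<longleftrightarrow>
    fst p = fst q \<and> (\<forall>x\<in>Obj \<A>. snd p x () \<sqsubseteq>\<^bsub>Hom Q (tp \<A> x) (fst q)\<^esub> snd q x ())"
proof (cases "fst p = fst q")
  case True
  have "tp \<A> x \<in> Ob Q" if "x \<in> Obj \<A>" for x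
    using that assms(1) by (auto simp: qcategory_def)
  then show ?thesis
    using True assms le_presheaves_hom_iff[OF assms, of "Unit Q (fst p)"]
      presheaf_closed[OF assms(1,2)] presheaf_type[OF assms(2)]
    by (simp add: qle_def unit_closed unit_left)
qed (simp add: qle_def)

lemma presheaves_qcategory:
  assumes "qcategory Q \<A>"
  shows "qcategory Q (presheaves Q \<A>)"
proof -
  let ?P = "presheaves Q \<A>"
  have tA: "tp \<A> x \<in> Ob Q" if "x \<in> Obj \<A>" for x
    using that assms by (auto simp: qcategory_def)
  note c = presheaves_hom_closed[OF assms] presheaf_closed[OF assms] presheaf_type[where \<A> = \<A>] tA
  have "Unit Q (fst p) \<sqsubseteq>\<^bsub>Hom Q (fst p) (fst p)\<^esub> Arr ?P p p" if "p \<in> Obj ?P" for p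
    using that c
    by (simp add: le_presheaves_hom_iff[OF assms] unit_closed unit_left hom_refl)
  moreover have "Comp Q (fst p) (fst q) (fst r) (Arr ?P q r) (Arr ?P p q)
      \<sqsubseteq>\<^bsub>Hom Q (fst p) (fst r)\<^esub> Arr ?P p r"
    if "p \<in> Obj ?P" "q \<in> Obj ?P" "r \<in> Obj ?P" for p q r
    using that
    by (auto simp: le_presheaves_hom_iff[OF assms] comp_closed c
        intro!: contract_right[where m = "snd q _ ()"] presheaves_hom_comp_le[OF assms])
  ultimately show ?thesis
    unfolding qcategory_def using c by simp
qed

section \<open>The adjunction\<close>

text \<open>
  With $h = \mathcal{P}\mathbb{B}(\mu,\nu)$, the claim $h \circ (\mu \circ \phi) \le \nu \circ \phi$
  follows from $h \circ \mu \le \nu$.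
\<close>

lemma upper_star_qfunctor:
  assumes \<A>: "qcategory Q \<A>" and \<B>: "qcategory Q \<B>" and \<phi>: "distributor Q \<A> \<B> \<phi>"
  shows "qfunctor Q (presheaves Q \<B>) (presheaves Q \<A>) (upper_star Q \<A> \<B> \<phi>)"
proof -
  let ?PA = "presheaves Q \<A>" and ?PB = "presheaves Q \<B>" and ?F = "upper_star Q \<A> \<B> \<phi>"
  note m\<phi> = distributor_matrix[OF \<A> \<B> \<phi>]
  note m = hom_matrixD[OF m\<phi>]
  have F_apply: "fst (?F p) = fst p" "snd (?F p) = dcomp Q \<A> \<B> (star Q (fst p)) (snd p) \<phi>"
    if "p \<in> Obj ?PB" for p
    using that by (auto simp: upper_star_def split: prod.splits)
  have F: "?F p \<in> Obj ?PA" if "p \<in> Obj ?PB" for p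
    using that by (auto simp: upper_star_def presheaves_def
        intro!: dcomp_distributor[OF \<A> \<B> star_qcategory \<phi>])
  have mp: "hom_matrix Q \<B> (star Q (fst p)) (snd p)" if "p \<in> Obj ?PB" for p
    using that by (intro presheaf_matrix[OF \<B>]) simp
  note c = presheaves_hom_closed[OF \<B>] presheaf_closed[OF \<B>] presheaf_type[where \<A> = \<B>]
  have snd_closed: "snd (?F p) x () \<in> carrier (Hom Q (tp \<A> x) (fst p))"
    if "p \<in> Obj ?PB" "x \<in> Obj \<A>" for p x
    using presheaf_closed[OF \<A> F[OF that(1)] that(2)] F_apply(1)[OF that(1)] by simp
  have mono: "Arr ?PB p q \<sqsubseteq>\<^bsub>Hom Q (fst p) (fst q)\<^esub> Arr ?PA (?F p) (?F q)"
    if pq: "p \<in> Obj ?PB" "q \<in> Obj ?PB" for p q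
  proof -
    have "Comp Q (tp \<A> x) (fst p) (fst q) (Arr ?PB p q) (snd (?F p) x ())
        \<sqsubseteq>\<^bsub>Hom Q (tp \<A> x) (fst q)\<^esub> snd (?F q) x ()" if x: "x \<in> Obj \<A>" for x
    proof -
      have "Comp Q (tp \<A> x) (fst p) (fst q) (Arr ?PB p q)
            (Comp Q (tp \<A> x) (tp \<B> y) (fst p) (snd p y ()) (\<phi> x y))
          \<sqsubseteq>\<^bsub>Hom Q (tp \<A> x) (fst q)\<^esub> snd (?F q) x ()" if y: "y \<in> Obj \<B>" for y
        using pq x y m c snd_closed comp_le_dcomp[OF m\<phi> mp[OF pq(2)] x y, of "()"]
        by (intro contract_left[where m = "snd q y ()"] presheaves_hom_comp_le[OF \<B>])
          (simp_all add: F_apply)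
      then show ?thesis
        using pq x m c snd_closed[OF pq(2) x]
          comp_dcomp_le_iff[OF m\<phi> mp[OF pq(1)] x, of "()" "fst q" "Arr ?PB p q"]
        by (simp add: F_apply)
    qed
    then show ?thesis
      using le_presheaves_hom_iff[OF \<A> F F, of p q "Arr ?PB p q"] pq c F_apply(1) by simp
  qed
  show ?thesis
    unfolding qfunctor_def
    using F F_apply(1) mono presheaves_qcategory[OF \<A>] presheaves_qcategory[OF \<B>]
    by (auto simp: PiE_def upper_star_def)
qed

text \<open>
  With $h = \mathcal{P}\mathbb{A}(\mu,\nu)$, the claim
  $h \circ (\mu \swarrow \phi) \le \nu \swarrow \phi$ transposes to
  $(h \circ (\mu \swarrow \phi)) \circ \phi \le \nu$, and
  $(\mu \swarrow \phi) \circ \phi \le \mu$ reduces it to $h \circ \mu \le \nu$.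
\<close>

lemma lower_star_qfunctor:
  assumes \<A>: "qcategory Q \<A>" and \<B>: "qcategory Q \<B>" and \<phi>: "distributor Q \<A> \<B> \<phi>"
  shows "qfunctor Q (presheaves Q \<A>) (presheaves Q \<B>) (lower_star Q \<A> \<B> \<phi>)"
proof -
  let ?PA = "presheaves Q \<A>" and ?PB = "presheaves Q \<B>" and ?G = "lower_star Q \<A> \<B> \<phi>"
  note m\<phi> = distributor_matrix[OF \<A> \<B> \<phi>]
  note m = hom_matrixD[OF m\<phi>]
  have G_apply: "fst (?G p) = fst p" "snd (?G p) = dlimp Q \<A> \<B> (star Q (fst p)) (snd p) \<phi>"
    if "p \<in> Obj ?PA" for p
    using that by (auto simp: lower_star_def split: prod.splits)
  have G: "?G p \<in> Obj ?PB" if "p \<in> Obj ?PA" for p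
    using that by (auto simp: lower_star_def presheaves_def
        intro!: dlimp_distributor[OF \<A> \<B> star_qcategory \<phi>])
  have mp: "hom_matrix Q \<A> (star Q (fst p)) (snd p)" if "p \<in> Obj ?PA" for p
    using that by (intro presheaf_matrix[OF \<A>]) simp
  note c = presheaves_hom_closed[OF \<A>] presheaf_closed[OF \<A>] presheaf_type[where \<A> = \<A>]
  have snd_closed: "snd (?G p) y () \<in> carrier (Hom Q (tp \<B> y) (fst p))"
    if "p \<in> Obj ?PA" "y \<in> Obj \<B>" for p y
    using presheaf_closed[OF \<B> G[OF that(1)] that(2)] G_apply(1)[OF that(1)] by simp
  have mono: "Arr ?PA p q \<sqsubseteq>\<^bsub>Hom Q (fst p) (fst q)\<^esub> Arr ?PB (?G p) (?G q)"
    if pq: "p \<in> Obj ?PA" "q \<in> Obj ?PA" for p q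
  proof -
    have "Comp Q (tp \<B> y) (fst p) (fst q) (Arr ?PA p q) (snd (?G p) y ())
        \<sqsubseteq>\<^bsub>Hom Q (tp \<B> y) (fst q)\<^esub> snd (?G q) y ()" if y: "y \<in> Obj \<B>" for y
    proof -
      have "Comp Q (tp \<A> x) (tp \<B> y) (fst q)
            (Comp Q (tp \<B> y) (fst p) (fst q) (Arr ?PA p q) (snd (?G p) y ())) (\<phi> x y)
          \<sqsubseteq>\<^bsub>Hom Q (tp \<A> x) (fst q)\<^esub> snd q x ()" if x: "x \<in> Obj \<A>" for x
        using pq x y m c snd_closed dlimp_comp_le[OF m\<phi> mp[OF pq(1)] x y, of "()"]
        by (intro contract_right[where m = "snd p x ()"] presheaves_hom_comp_le[OF \<A>])
          (simp_all add: G_apply)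
      then show ?thesis
        using pq y m c snd_closed[OF pq(1) y]
          le_dlimp_iff[OF m\<phi> mp[OF pq(2)] y, of "()"
            "Comp Q (tp \<B> y) (fst p) (fst q) (Arr ?PA p q) (snd (?G p) y ())"]
        by (simp add: G_apply comp_closed)
    qed
    then show ?thesis
      using le_presheaves_hom_iff[OF \<B> G G, of p q "Arr ?PA p q"] pq c G_apply(1) by simp
  qed
  show ?thesis
    unfolding qfunctor_def
    using G G_apply(1) mono presheaves_qcategory[OF \<A>] presheaves_qcategory[OF \<B>]
    by (auto simp: PiE_def lower_star_def)
qed

lemma upper_star_lower_star_adjoint:
  assumes \<A>: "qcategory Q \<A>" and \<B>: "qcategory Q \<B>" and \<phi>: "distributor Q \<A> \<B> \<phi>"
  shows "left_adjoint Q (presheaves Q \<B>) (presheaves Q \<A>)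
    (upper_star Q \<A> \<B> \<phi>) (lower_star Q \<A> \<B> \<phi>)"
proof -
  let ?PA = "presheaves Q \<A>" and ?PB = "presheaves Q \<B>"
  let ?F = "upper_star Q \<A> \<B> \<phi>" and ?G = "lower_star Q \<A> \<B> \<phi>"
  note m\<phi> = distributor_matrix[OF \<A> \<B> \<phi>]
  note F = upper_star_qfunctor[OF assms] and G = lower_star_qfunctor[OF assms]
  have F_closed: "?F p \<in> Obj ?PA" if "p \<in> Obj ?PB" for p
    using F that by (auto simp: qfunctor_def)
  have G_closed: "?G p \<in> Obj ?PB" if "p \<in> Obj ?PA" for p
    using G that by (auto simp: qfunctor_def)
  have unit: "qle Q ?PB p (?G (?F p))" if p: "p \<in> Obj ?PB" for p
  proof -
    obtain X \<nu> where [simp]: "p = (X, \<nu>)" by (cases p)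
    note m\<nu> = presheaf_matrix[OF \<B> p[simplified]]
    let ?\<mu> = "dcomp Q \<A> \<B> (star Q X) \<nu> \<phi>"
    have Fp: "?F p = (X, ?\<mu>)" using p by (simp add: upper_star_def)
    then have GFp: "?G (?F p) = (X, dlimp Q \<A> \<B> (star Q X) ?\<mu> \<phi>)"
      using F_closed[OF p] by (simp add: lower_star_def)
    have "\<nu> y () \<sqsubseteq>\<^bsub>Hom Q (tp \<B> y) X\<^esub> dlimp Q \<A> \<B> (star Q X) ?\<mu> \<phi> y ()"
      if y: "y \<in> Obj \<B>" for y
      using le_dlimp_iff[OF m\<phi> dcomp_matrix[OF m\<phi> m\<nu>] y, of "()" "\<nu> y ()"]
        comp_le_dcomp[OF m\<phi> m\<nu> _ y, of _ "()"] hom_matrixD(3)[OF m\<nu> y, of "()"] by simp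
    then show ?thesis
      using presheaves_qle_iff[OF \<B> p G_closed[OF F_closed[OF p]]] GFp by simp
  qed
  have counit: "qle Q ?PA (?F (?G p)) p" if p: "p \<in> Obj ?PA" for p
  proof -
    obtain X \<mu> where [simp]: "p = (X, \<mu>)" by (cases p)
    note m\<mu> = presheaf_matrix[OF \<A> p[simplified]]
    let ?\<nu> = "dlimp Q \<A> \<B> (star Q X) \<mu> \<phi>"
    have Gp: "?G p = (X, ?\<nu>)" using p by (simp add: lower_star_def)
    then have FGp: "?F (?G p) = (X, dcomp Q \<A> \<B> (star Q X) ?\<nu> \<phi>)"
      using G_closed[OF p] by (simp add: upper_star_def)
    have "dcomp Q \<A> \<B> (star Q X) ?\<nu> \<phi> x () \<sqsubseteq>\<^bsub>Hom Q (tp \<A> x) X\<^esub> \<mu> x ()"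
      if x: "x \<in> Obj \<A>" for x
      using dcomp_le_iff[OF m\<phi> dlimp_matrix[OF m\<phi> m\<mu>] x, of "()" "\<mu> x ()"]
        dlimp_comp_le[OF m\<phi> m\<mu> x, of _ "()"] hom_matrixD(3)[OF m\<mu> x, of "()"] by simp
    then show ?thesis
      using presheaves_qle_iff[OF \<A> F_closed[OF G_closed[OF p]] p] FGp by simp
  qed
  show ?thesis
    unfolding left_adjoint_def qfunctor_le_def
    using F G unit counit by (simp add: compose_def)
qed

end

theorem proposition5p1:
  fixes Q :: "('o, 'a) quantaloid_data"
    and \<A> :: "('o, 'a, 'x) qcat"
    and \<B> :: "('o, 'a, 'y) qcat"
    and \<phi> :: "'x \<Rightarrow> 'y \<Rightarrow> 'a"
  assumes "quantaloid Q"
    and "qcategory Q \<A>"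
    and "qcategory Q \<B>"
    and "distributor Q \<A> \<B> \<phi>"
  shows "left_adjoint Q (presheaves Q \<B>) (presheaves Q \<A>)
           (upper_star Q \<A> \<B> \<phi>) (lower_star Q \<A> \<B> \<phi>)"
  using assms by (rule quantaloid.upper_star_lower_star_adjoint)

end
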